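(* Every CAT(0) space is $C$-rCAT(0) for $C=2+\sqrt3$.
   Context: CAT(0) spaces are (not necessarily complete) geodesic metric spaces all of whose geodesic triangles satisfy the usual Euclidean comparison inequality. For $h\ge 0$, an $h$-short segment $[x,y]_h$ from $x$ to $y$ in a metric space $(X,d)$ is a path $\gamma:[0,L]\to X$ from $x$ to $y$ with $\mathrm{len}(\gamma)\le d(x,y)+h$. For a point $u=\gamma(t)$ on it, $[x,u]_h$ and $[u,y]_h$ denote the subpaths $\gamma|_{[0,t]}$ and $\gamma|_{[t,L]}$. An $h$-short triangle $T_h(x,y,z)$ consists of $x,y,z\in X$ with a choice of $h$-short segments (sides) $[x,y]_h,[y,z]_h,[z,x]_h$. A comparison triangle is a Euclidean triangle $T(\bar x,\bar y,\bar z)$ in the plane with $|\bar x-\bar y|=d(x,y)$, $|\bar y-\bar z|=d(y,z)$, $|\bar z-\bar x|=d(z,x)$. A comparison point for $u\in[x,y]_h$ is any $\bar u\in[\bar x,\bar y]$ with $|\bar x-\bar u|\le\mathrm{len}([x,u]_h)$ and $|\bar u-\bar y|\le\mathrm{len}([u,y]_h)$ (not necessarily unique); similarly for the other sides. A length space $X$ is $C$-rCAT(0) ($C>0$) if for all $x,y,z\in X$ and every $h$-short triangle $T_h(x,y,z)$ with $h=1/\max\{1,d(x,y),d(x,z),d(y,z)\}$, one has $d(u,v)\le|\bar u-\bar v|+C$ whenever $u,v$ lie on different sides of $T_h(x,y,z)$ and $\bar u,\bar v$ are corresponding comparison points on a comparison triangle. *)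

theory Defs
  imports "HOL-Analysis.Analysis"
begin

context Metric_space
begin

definition mpath :: "real \<Rightarrow> (real \<Rightarrow> 'a) \<Rightarrow> 'a \<Rightarrow> 'a \<Rightarrow> bool" where
  "mpath L \<gamma> x y \<longleftrightarrow>
     0 \<le> L \<and> continuous_map (top_of_set {0..L}) mtopology \<gamma> \<and> \<gamma> 0 = x \<and> \<gamma> L = y"

(* Length of the restriction of \<gamma> to {a..b}: the supremum over all partitions
   a = t 0 \<le> \<dots> \<le> t n = b, with value \<infinity> for non-rectifiable paths. *)
definition mpath_len :: "(real \<Rightarrow> 'a) \<Rightarrow> real \<Rightarrow> real \<Rightarrow> ennreal" where
  "mpath_len \<gamma> a b =
     (SUP (n, t) \<in> {(n :: nat, t :: nat \<Rightarrow> real). t 0 = a \<and> t n = b \<and> (\<forall>i<n. t i \<le> t (Suc i))}.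
        ennreal (\<Sum>i<n. d (\<gamma> (t i)) (\<gamma> (t (Suc i)))))"

definition short_segment :: "real \<Rightarrow> real \<Rightarrow> (real \<Rightarrow> 'a) \<Rightarrow> 'a \<Rightarrow> 'a \<Rightarrow> bool" where
  "short_segment h L \<gamma> x y \<longleftrightarrow> mpath L \<gamma> x y \<and> mpath_len \<gamma> 0 L \<le> ennreal (d x y + h)"

definition geodesic_segment :: "(real \<Rightarrow> 'a) \<Rightarrow> 'a \<Rightarrow> 'a \<Rightarrow> bool" where
  "geodesic_segment \<gamma> x y \<longleftrightarrow>
     \<gamma> ` {0..d x y} \<subseteq> M \<and> \<gamma> 0 = x \<and> \<gamma> (d x y) = y \<and>
     (\<forall>s\<in>{0..d x y}. \<forall>t\<in>{0..d x y}. d (\<gamma> s) (\<gamma> t) = \<bar>s - t\<bar>)"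

(* Triangles have vertices p 0, p 1, p 2; side number i runs from p i to p (Suc i mod 3). *)
definition short_triangle ::
    "real \<Rightarrow> (nat \<Rightarrow> real) \<Rightarrow> (nat \<Rightarrow> real \<Rightarrow> 'a) \<Rightarrow> (nat \<Rightarrow> 'a) \<Rightarrow> bool" where
  "short_triangle h L \<gamma> p \<longleftrightarrow>
     (\<forall>i<3. p i \<in> M \<and> short_segment h (L i) (\<gamma> i) (p i) (p (Suc i mod 3)))"

definition geodesic_triangle :: "(nat \<Rightarrow> real \<Rightarrow> 'a) \<Rightarrow> (nat \<Rightarrow> 'a) \<Rightarrow> bool" where
  "geodesic_triangle \<gamma> p \<longleftrightarrow>
     (\<forall>i<3. p i \<in> M \<and> geodesic_segment (\<gamma> i) (p i) (p (Suc i mod 3)))"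

definition comparison_triangle :: "(nat \<Rightarrow> 'a) \<Rightarrow> (nat \<Rightarrow> real^2) \<Rightarrow> bool" where
  "comparison_triangle p p' \<longleftrightarrow>
     (\<forall>i<3. dist (p' i) (p' (Suc i mod 3)) = d (p i) (p (Suc i mod 3)))"

definition geodesic_comparison_point ::
    "'a \<Rightarrow> 'a \<Rightarrow> real^2 \<Rightarrow> real^2 \<Rightarrow> real^2 \<Rightarrow> bool" where
  "geodesic_comparison_point x u x' y' u' \<longleftrightarrow>
     u' \<in> closed_segment x' y' \<and> dist x' u' = d x u"

(* Comparison points for u = \<gamma> t; as \<gamma> need not be injective, the subpaths from x to u and
   from u to y, hence the comparison points, depend on the parameter t and not just on u. *)
definition short_comparison_point ::
    "real \<Rightarrow> (real \<Rightarrow> 'a) \<Rightarrow> real \<Rightarrow> real^2 \<Rightarrow> real^2 \<Rightarrow> real^2 \<Rightarrow> bool" where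
  "short_comparison_point L \<gamma> t x' y' u' \<longleftrightarrow>
     u' \<in> closed_segment x' y' \<and>
     ennreal (dist x' u') \<le> mpath_len \<gamma> 0 t \<and>
     ennreal (dist u' y') \<le> mpath_len \<gamma> t L"

end

locale geodesic_space = Metric_space +
  assumes ex_geodesic: "\<lbrakk>x \<in> M; y \<in> M\<rbrakk> \<Longrightarrow> \<exists>\<gamma>. geodesic_segment \<gamma> x y"

locale length_space = Metric_space +
  assumes dist_eq_Inf_len:
    "\<lbrakk>x \<in> M; y \<in> M\<rbrakk> \<Longrightarrow> ennreal (d x y) = Inf {mpath_len \<gamma> 0 L |L \<gamma>. mpath L \<gamma> x y}"

locale CAT0_space = geodesic_space +
  assumes CAT0_inequality:
    "\<lbrakk>geodesic_triangle \<gamma> p; comparison_triangle p p';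
      i < 3; j < 3;
      s \<in> {0..d (p i) (p (Suc i mod 3))}; t \<in> {0..d (p j) (p (Suc j mod 3))};
      geodesic_comparison_point (p i) (\<gamma> i s) (p' i) (p' (Suc i mod 3)) u';
      geodesic_comparison_point (p j) (\<gamma> j t) (p' j) (p' (Suc j mod 3)) v'\<rbrakk>
     \<Longrightarrow> d (\<gamma> i s) (\<gamma> j t) \<le> dist u' v'"

locale rCAT0_space = length_space +
  fixes C :: real
  assumes C_pos: "0 < C"
    and rCAT0_inequality:
    "\<lbrakk>h = 1 / Max {1, d (p 0) (p 1), d (p 0) (p 2), d (p 1) (p 2)};
      short_triangle h L \<gamma> p; comparison_triangle p p';
      i < 3; j < 3; i \<noteq> j;
      s \<in> {0..L i}; t \<in> {0..L j};
      short_comparison_point (L i) (\<gamma> i) s (p' i) (p' (Suc i mod 3)) u';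
      short_comparison_point (L j) (\<gamma> j) t (p' j) (p' (Suc j mod 3)) v'\<rbrakk>
     \<Longrightarrow> d (\<gamma> i s) (\<gamma> j t) \<le> dist u' v' + C"

end

(* A point u of an h-short segment from x to y has distances at most r + a and D - r + b to the
   endpoints, where D = d x y, r is the position of the comparison point and a + b <= h. Stewart's
   theorem in the comparison triangle of (u, x, y) then bounds the squared distance from u to the
   point at parameter r of a geodesic by h * D / 2 + h^2, which is at most 3/2 for the prescribed h.
   Moving both u and v to geodesic sides therefore costs at most 2 * sqrt (3/2) < 2 + sqrt 3. *)

theory Submission
  imports Defs
begin

section \<open>Euclidean geometry: Stewart's theorem and triangles with prescribed sides\<close>

lemma stewart_norm:
  fixes a b c :: "'a::real_inner"
  shows "(dist a ((1 - l) *\<^sub>R b + l *\<^sub>R c))\<^sup>2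
    = (1 - l) * (dist a b)\<^sup>2 + l * (dist a c)\<^sup>2 - l * (1 - l) * (dist b c)\<^sup>2"
  unfolding dist_norm power2_norm_eq_inner
  by (simp add: algebra_simps inner_commute)

text \<open>Provides comparison triangles. Place \<open>b\<close> at the origin and \<open>c\<close>
  at distance \<open>D\<close> on the first axis; the law of cosines then determines
  \<open>a\<close> up to reflection.\<close>

lemma ex_euclidean_triangle:
  fixes A B D :: real
  assumes "D \<le> A + B" "A \<le> B + D" "B \<le> A + D"
  shows "\<exists>a b c :: real^2. dist a b = A \<and> dist b c = D \<and> dist c a = B"
proof -
  have nn: "0 \<le> A" "0 \<le> B" "0 \<le> D" using assms by linarith+
  have dist2: "dist (vector [p, q] :: real^2) (vector [p', q']) = sqrt ((p - p')\<^sup>2 + (q - q')\<^sup>2)"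
    for p q p' q' :: real
    by (simp add: dist_norm norm_eq_sqrt_inner inner_vec_def sum_2 power2_eq_square)
  show ?thesis
  proof (cases "D = 0")
    case True
    then have "A = B" using assms by simp
    then have "dist (vector [A, 0] :: real^2) (vector [0, 0]) = A"
      "dist (vector [0, 0] :: real^2) (vector [0, 0]) = D"
      "dist (vector [0, 0] :: real^2) (vector [A, 0]) = B"
      using nn True by (simp_all add: dist2)
    then show ?thesis by blast
  next
    case False
    \<comment> \<open>First coordinate of \<open>a\<close>, from the law of cosines. The triangle
      inequalities amount to \<open>\<bar>s\<bar> \<le> A\<close>, so the second coordinate
      \<open>sqrt (A\<^sup>2 - s\<^sup>2)\<close> makes sense.\<close>
    define s where "s = (A\<^sup>2 + D\<^sup>2 - B\<^sup>2) / (2 * D)"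
    have D: "D > 0" using False nn by simp
    have s: "2 * D * s = A\<^sup>2 + D\<^sup>2 - B\<^sup>2" using D by (simp add: s_def)
    have "\<bar>D - A\<bar> \<le> B" using assms by linarith
    then have "\<bar>D - A\<bar>\<^sup>2 \<le> B\<^sup>2" "B\<^sup>2 \<le> (A + D)\<^sup>2"
      using assms nn by (blast intro: power_mono abs_ge_zero)+
    then have "D * s \<le> D * A" "D * (- s) \<le> D * A"
      using s by (auto simp: power2_eq_square algebra_simps)
    then have "\<bar>s\<bar> \<le> A" using D by (simp only: mult_le_cancel_left_pos abs_le_iff)
    then have "s\<^sup>2 \<le> A\<^sup>2" using nn by (simp add: abs_le_square_iff[symmetric])
    then have t: "(sqrt (A\<^sup>2 - s\<^sup>2))\<^sup>2 = A\<^sup>2 - s\<^sup>2" by simp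
    have e: "(D - s)\<^sup>2 + (A\<^sup>2 - s\<^sup>2) = B\<^sup>2"
      using s by (simp add: power2_eq_square algebra_simps)
    have "dist (vector [s, sqrt (A\<^sup>2 - s\<^sup>2)] :: real^2) (vector [0, 0]) = A"
      "dist (vector [0, 0] :: real^2) (vector [D, 0]) = D"
      "dist (vector [D, 0] :: real^2) (vector [s, sqrt (A\<^sup>2 - s\<^sup>2)]) = B"
      using nn by (simp_all add: dist2 t e)
    then show ?thesis by blast
  qed
qed

section \<open>Lengths of paths in metric spaces\<close>

context Metric_space
begin

lemma dist_le_mpath_len:
  assumes "a \<le> b"
  shows "ennreal (d (\<gamma> a) (\<gamma> b)) \<le> mpath_len \<gamma> a b"
  unfolding mpath_len_def
  by (rule SUP_upper2[where i = "(1, \<lambda>i. if i = 0 then a else b)"]) (use assms in auto)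

text \<open>A partition of \<open>{a..b}\<close> followed by one of \<open>{b..c}\<close> is a
  partition of \<open>{a..c}\<close>, and the sums add up. Taking suprema over the two partitions
  one after the other gives the claim.\<close>

lemma mpath_len_superadditive:
  assumes "a \<le> b" "b \<le> c"
  shows "mpath_len \<gamma> a b + mpath_len \<gamma> b c \<le> mpath_len \<gamma> a c"
proof -
  define P where "P a b = {(n :: nat, t :: nat \<Rightarrow> real). t 0 = a \<and> t n = b \<and> (\<forall>i<n. t i \<le> t (Suc i))}"
    for a b
  define S where "S = (\<lambda>(n, t). ennreal (\<Sum>i<n. d (\<gamma> (t i)) (\<gamma> (t (Suc i)))))"
  have len: "mpath_len \<gamma> a b = (SUP x\<in>P a b. S x)" for a b
    by (simp add: mpath_len_def P_def S_def)
  \<comment> \<open>In \<open>ennreal\<close>, adding a constant commutes with suprema over nonempty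
    sets; the empty supremum is 0.\<close>
  have ne: "P a b \<noteq> {}" if "a \<le> b" for a b
  proof -
    have "(1, \<lambda>i. if i = 0 then a else b) \<in> P a b" using that by (auto simp: P_def)
    then show ?thesis by blast
  qed
  have "S x + S y \<le> mpath_len \<gamma> a c" if xy: "x \<in> P a b" "y \<in> P b c" for x y
  proof -
    obtain n t m u where [simp]: "x = (n, t)" "y = (m, u)" by (metis surj_pair)
    have t: "t 0 = a" "t n = b" "\<And>i. i < n \<Longrightarrow> t i \<le> t (Suc i)"
      and u: "u 0 = b" "u m = c" "\<And>i. i < m \<Longrightarrow> u i \<le> u (Suc i)"
      using xy by (auto simp: P_def)
    \<comment> \<open>At the joint \<open>i = n\<close> both pieces have the value \<open>b\<close>,
      so \<open>w (n + i) = u i\<close> holds for \<open>i = 0\<close> too.\<close>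
    define w where "w i = (if i \<le> n then t i else u (i - n))" for i
    have w_low: "w i = t i" if "i \<le> n" for i using that by (simp add: w_def)
    have w_high: "w (n + i) = u i" for i using t u by (simp add: w_def)
    have step: "w i \<le> w (Suc i)" if "i < n + m" for i
    proof (cases "i < n")
      case True
      then show ?thesis using t(3) by (simp add: w_low)
    next
      case False
      then obtain k where k: "i = n + k" using le_Suc_ex not_less by blast
      with that have "k < m" by simp
      with u(3) show ?thesis by (metis k w_high add_Suc_right)
    qed
    have "(n + m, w) \<in> P a c"
      using t u step w_low[of 0] w_high[of m] by (simp add: P_def)
    moreover have "S (n + m, w) = S x + S y"
    proof -
      have split: "(\<Sum>i<n+m. f i) = (\<Sum>i<n. f i) + (\<Sum>i<m. f (n + i))" for f :: "nat \<Rightarrow> real"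
        by (induction m) (auto simp: add_ac)
      have high: "w (Suc (n + i)) = u (Suc i)" for i using w_high[of "Suc i"] by simp
      have low: "(\<Sum>i<n. d (\<gamma> (w i)) (\<gamma> (w (Suc i)))) = (\<Sum>i<n. d (\<gamma> (t i)) (\<gamma> (t (Suc i))))"
        by (rule sum.cong) (auto simp: w_low)
      show ?thesis
        by (simp add: S_def split low w_high high sum_nonneg flip: ennreal_plus)
    qed
    ultimately show ?thesis unfolding len by (metis SUP_upper)
  qed
  then have "(SUP x\<in>P a b. S x) + S y \<le> mpath_len \<gamma> a c" if "y \<in> P b c" for y
    using that ne assms by (subst ennreal_SUP_add_left[symmetric]) (blast intro: SUP_least)+
  then have "(SUP y\<in>P b c. mpath_len \<gamma> a b + S y) \<le> mpath_len \<gamma> a c"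
    unfolding len[of a b] by (blast intro: SUP_least)
  then show ?thesis using ne assms by (simp add: ennreal_SUP_add_right len)
qed

lemma geodesic_segment_imp_mpath:
  assumes "geodesic_segment \<gamma> x y"
  shows "mpath (d x y) \<gamma> x y"
proof -
  have \<gamma>: "\<gamma> ` {0..d x y} \<subseteq> M"
    "\<And>s t. s \<in> {0..d x y} \<Longrightarrow> t \<in> {0..d x y} \<Longrightarrow> d (\<gamma> s) (\<gamma> t) = \<bar>s - t\<bar>"
    using assms by (auto simp: geodesic_segment_def)
  have "\<exists>U. openin (top_of_set {0..d x y}) U \<and> s \<in> U \<and> (\<forall>t\<in>U. \<gamma> t \<in> mball (\<gamma> s) e)"
    if "s \<in> {0..d x y}" "0 < e" for s e
  proof (intro exI conjI ballI)
    show "openin (top_of_set {0..d x y}) ({0..d x y} \<inter> ball s e)" by blast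
    fix t assume "t \<in> {0..d x y} \<inter> ball s e"
    then show "\<gamma> t \<in> mball (\<gamma> s) e"
      using \<gamma> that by (auto simp: dist_real_def)
  qed (use that in auto)
  then have "continuous_map (top_of_set {0..d x y}) mtopology \<gamma>"
    using \<gamma>(1) by (auto simp: continuous_map_to_metric)
  then show ?thesis
    using assms by (auto simp: mpath_def geodesic_segment_def)
qed

text \<open>Along a geodesic each term of a partition sum is a difference of consecutive parameters,
  so the sum telescopes.\<close>

lemma mpath_len_geodesic_le:
  assumes "geodesic_segment \<gamma> x y"
  shows "mpath_len \<gamma> 0 (d x y) \<le> ennreal (d x y)"
proof -
  have "(\<Sum>i<n. d (\<gamma> (t i)) (\<gamma> (t (Suc i)))) = d x y"
    if t: "t 0 = 0" "t n = d x y" "\<forall>i<n. t i \<le> t (Suc i)" for n t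
  proof -
    \<comment> \<open>Monotonicity keeps all partition points inside \<open>{0..d x y}\<close>,
      where \<open>\<gamma>\<close> is known to be isometric.\<close>
    have mono: "t i \<le> t j" if "i \<le> j" "j \<le> n" for i j
      using that
    proof (induction j rule: dec_induct)
      case (step k)
      then have "t k \<le> t (Suc k)" "t i \<le> t k" using t(3) by auto
      then show ?case by linarith
    qed simp
    have "t i \<in> {0..d x y}" if "i \<le> n" for i
      using mono[of 0 i] mono[of i n] that t by auto
    then have "(\<Sum>i<n. d (\<gamma> (t i)) (\<gamma> (t (Suc i)))) = (\<Sum>i<n. t (Suc i) - t i)"
      using t(3) assms by (intro sum.cong) (auto simp: geodesic_segment_def)
    also have "\<dots> = d x y" using t by (simp add: sum_lessThan_telescope)
    finally show ?thesis .
  qed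
  then show ?thesis unfolding mpath_len_def by (auto intro!: SUP_least)
qed

lemma mpath_in_space:
  assumes "mpath L \<gamma> x y" "t \<in> {0..L}"
  shows "\<gamma> t \<in> M"
  using assms continuous_map_image_subset_topspace[of "top_of_set {0..L}" mtopology \<gamma>]
  by (auto simp: mpath_def)

text \<open>Here \<open>a\<close> and \<open>b\<close> are the excesses of the lengths of the two
  subpaths over the two parts of the comparison side. They are nonnegative by the choice of
  \<open>u'\<close>, and superadditivity of length bounds their sum by \<open>h\<close>.\<close>

lemma short_comparison_point_bounds:
  assumes seg: "short_segment h L \<gamma> x y" and h: "0 \<le> h" and t: "t \<in> {0..L}"
    and cmp: "short_comparison_point L \<gamma> t x' y' u'" and xy: "dist x' y' = d x y"
  shows "\<exists>a b. 0 \<le> a \<and> 0 \<le> b \<and> a + b \<le> h \<and>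
    d x (\<gamma> t) \<le> dist x' u' + a \<and> d (\<gamma> t) y \<le> d x y - dist x' u' + b"
proof -
  have [simp]: "\<gamma> 0 = x" "\<gamma> L = y" and "0 \<le> L"
    using seg by (auto simp: short_segment_def mpath_def)
  define p q where "p = enn2real (mpath_len \<gamma> 0 t)" and "q = enn2real (mpath_len \<gamma> t L)"
  have le: "mpath_len \<gamma> 0 t + mpath_len \<gamma> t L \<le> ennreal (d x y + h)"
    using mpath_len_superadditive[of 0 t L \<gamma>] t seg by (auto simp: short_segment_def)
  \<comment> \<open>Finiteness must come first, because \<open>enn2real\<close> sends infinity to
    0.\<close>
  then have "mpath_len \<gamma> 0 t + mpath_len \<gamma> t L < top"
    by (rule le_less_trans) simp
  then have pq: "mpath_len \<gamma> 0 t = ennreal p" "mpath_len \<gamma> t L = ennreal q"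
    and nn: "0 \<le> p" "0 \<le> q"
    by (auto simp: p_def q_def)
  have "p + q \<le> d x y + h"
    using le h nn by (simp add: pq ennreal_le_iff flip: ennreal_plus)
  moreover have "d x (\<gamma> t) \<le> p" "d (\<gamma> t) y \<le> q"
    using dist_le_mpath_len[of 0 t \<gamma>] dist_le_mpath_len[of t L \<gamma>] t nn
    by (simp_all add: pq ennreal_le_iff)
  moreover have "dist x' u' \<le> p" "dist u' y' \<le> q" "dist x' u' + dist u' y' = d x y"
    using cmp nn xy
    by (auto simp: short_comparison_point_def pq ennreal_le_iff
        between_mem_segment[symmetric] between)
  ultimately show ?thesis
    by (intro exI[where x = "p - dist x' u'"] exI[where x = "q - dist u' y'"]) auto
qed

end

text \<open>A geodesic attains the infimum of path lengths. This supplies the length space part of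
  \<open>rCAT0_space\<close>.\<close>

sublocale geodesic_space \<subseteq> length_space
proof
  fix x y assume xy: "x \<in> M" "y \<in> M"
  then obtain g where g: "geodesic_segment g x y" using ex_geodesic by blast
  show "ennreal (d x y) = Inf {mpath_len \<gamma> 0 L |L \<gamma>. mpath L \<gamma> x y}"
  proof (rule antisym)
    show "ennreal (d x y) \<le> Inf {mpath_len \<gamma> 0 L |L \<gamma>. mpath L \<gamma> x y}"
      using dist_le_mpath_len by (force simp: mpath_def intro!: Inf_greatest)
    show "Inf {mpath_len \<gamma> 0 L |L \<gamma>. mpath L \<gamma> x y} \<le> ennreal (d x y)"
      using g by (intro Inf_lower2[of "mpath_len g 0 (d x y)"])
        (auto intro: geodesic_segment_imp_mpath mpath_len_geodesic_le)
  qed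
qed

lemma less_3_nat_iff: "(\<forall>i<3::nat. P i) \<longleftrightarrow> P 0 \<and> P 1 \<and> P 2"
  by (auto simp: numeral_3_eq_3 less_Suc_eq numeral_2_eq_2)

section \<open>Distance from a point to a geodesic in a CAT(0) space\<close>

context CAT0_space
begin

text \<open>Comparison between a vertex and a point of the opposite side, with the Euclidean
  distance computed by Stewart's theorem.\<close>

lemma dist_geodesic_point_le:
  assumes u: "u \<in> M" and xy: "x \<in> M" "y \<in> M" and g: "geodesic_segment g x y"
    and l: "0 \<le> l" "l \<le> 1"
  shows "(d u (g (l * d x y)))\<^sup>2
    \<le> (1 - l) * (d u x)\<^sup>2 + l * (d u y)\<^sup>2 - l * (1 - l) * (d x y)\<^sup>2"
proof -
  obtain g0 g2 where g02: "geodesic_segment g0 u x" "geodesic_segment g2 y u"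
    using ex_geodesic u xy by meson
  obtain a b c :: "real^2" where abc: "dist a b = d u x" "dist b c = d x y" "dist c a = d y u"
    using ex_euclidean_triangle[of "d x y" "d u x" "d y u"] triangle u xy commute by (smt (verit))
  define p where "p i = (if i = 0 then u else if i = 1 then x else y)" for i :: nat
  define p' where "p' i = (if i = 0 then a else if i = 1 then b else c)" for i :: nat
  define \<gamma> where "\<gamma> i = (if i = 0 then g0 else if i = 1 then g else g2)" for i :: nat
  have tri: "geodesic_triangle \<gamma> p" "comparison_triangle p p'"
    using u xy g g02 abc
    by (auto simp: geodesic_triangle_def comparison_triangle_def less_3_nat_iff p_def p'_def \<gamma>_def)
  define v where "v = (1 - l) *\<^sub>R b + l *\<^sub>R c"
  have ld: "l * d x y \<in> {0..d x y}" using l by (auto simp: mult_left_le_one_le)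
  have dv: "dist b v = l * d x y"
  proof -
    have "b - v = l *\<^sub>R (b - c)" by (simp add: v_def algebra_simps)
    then show ?thesis using l abc by (simp add: dist_norm)
  qed
  have v: "geodesic_comparison_point x (g (l * d x y)) b c v"
  proof -
    have "v \<in> closed_segment b c" using l by (auto simp: v_def in_segment)
    moreover have "d x (g (l * d x y)) = l * d x y"
    proof -
      have "d (g 0) (g (l * d x y)) = \<bar>0 - l * d x y\<bar>"
        using g ld unfolding geodesic_segment_def by (meson atLeastAtMost_iff nonneg order_refl)
      then show ?thesis using g ld by (simp add: geodesic_segment_def)
    qed
    ultimately show ?thesis by (simp add: geodesic_comparison_point_def dv)
  qed
  \<comment> \<open>The vertex \<open>u\<close> enters as the starting point of side 0, with
    comparison point \<open>a\<close>.\<close>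
  have "d (\<gamma> 0 0) (\<gamma> 1 (l * d x y)) \<le> dist a v"
  proof (rule CAT0_inequality[OF tri])
    show "geodesic_comparison_point (p 0) (\<gamma> 0 0) (p' 0) (p' (Suc 0 mod 3)) a"
      using g02 u by (auto simp: p_def \<gamma>_def p'_def geodesic_comparison_point_def geodesic_segment_def)
    show "geodesic_comparison_point (p 1) (\<gamma> 1 (l * d x y)) (p' 1) (p' (Suc 1 mod 3)) v"
      using v by (simp add: p_def \<gamma>_def p'_def)
    show "l * d x y \<in> {0..d (p 1) (p (Suc 1 mod 3))}"
      using ld by (simp add: p_def)
  qed auto
  then have "d u (g (l * d x y)) \<le> dist a v"
    using g02 by (simp add: \<gamma>_def geodesic_segment_def)
  then have "(d u (g (l * d x y)))\<^sup>2 \<le> (dist a v)\<^sup>2" by (simp add: power_mono)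
  also have "\<dots> = (1 - l) * (d u x)\<^sup>2 + l * (d u y)\<^sup>2 - l * (1 - l) * (d x y)\<^sup>2"
    using abc by (simp add: v_def stewart_norm dist_commute commute)
  finally show ?thesis .
qed

text \<open>The geodesic point is taken at parameter \<open>dist x' u'\<close>, so that
  \<open>u'\<close> is a comparison point for it as well as for \<open>\<gamma> t\<close>.\<close>

lemma dist_short_segment_geodesic_le:
  assumes xy: "x \<in> M" "y \<in> M" and g: "geodesic_segment g x y"
    and seg: "short_segment h L \<gamma> x y" and h: "0 \<le> h" and t: "t \<in> {0..L}"
    and cmp: "short_comparison_point L \<gamma> t x' y' u'" and xy': "dist x' y' = d x y"
  shows "(d (\<gamma> t) (g (dist x' u')))\<^sup>2 \<le> h * d x y / 2 + h\<^sup>2"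
proof -
  let ?u = "\<gamma> t" and ?r = "dist x' u'" and ?D = "d x y"
  obtain a b where ab: "0 \<le> a" "0 \<le> b" "a + b \<le> h"
    and du: "d ?u x \<le> ?r + a" "d ?u y \<le> ?D - ?r + b"
    using short_comparison_point_bounds[OF seg h t cmp xy'] by (metis commute)
  have u: "?u \<in> M" using seg t mpath_in_space by (auto simp: short_segment_def)
  obtain l where l: "0 \<le> l" "l \<le> 1" "u' = (1 - l) *\<^sub>R x' + l *\<^sub>R y'"
    using cmp by (auto simp: short_comparison_point_def in_segment)
  have r: "?r = l * ?D"
  proof -
    have "x' - u' = l *\<^sub>R (x' - y')" by (simp add: l(3) algebra_simps)
    then show ?thesis using l xy' by (simp add: dist_norm)
  qed
  have "4 * (l * (1 - l)) \<le> 1"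
    using zero_le_power2[of "2 * l - 1"] by (simp add: power2_eq_square algebra_simps)
  then have l4: "l * (1 - l) \<le> 1 / 4" by simp
  have "(d ?u (g ?r))\<^sup>2 \<le> (1 - l) * (d ?u x)\<^sup>2 + l * (d ?u y)\<^sup>2 - l * (1 - l) * ?D\<^sup>2"
    unfolding r using dist_geodesic_point_le[OF u xy g l(1,2)] .
  also have "\<dots> \<le> (1 - l) * (?r + a)\<^sup>2 + l * (?D - ?r + b)\<^sup>2 - l * (1 - l) * ?D\<^sup>2"
    using l du by (intro diff_right_mono add_mono mult_left_mono power_mono) auto
  \<comment> \<open>With \<open>?r = l * ?D\<close> the terms in \<open>?D\<^sup>2\<close> cancel,
    and both cross terms carry the factor \<open>l * (1 - l)\<close>, which is at most 1/4.\<close>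
  also have "\<dots> = 2 * (?D * ((l * (1 - l)) * (a + b))) + ((1 - l) * a\<^sup>2 + l * b\<^sup>2)"
    unfolding r by (simp add: power2_eq_square algebra_simps)
  also have "\<dots> \<le> 2 * (?D * (1 / 4 * h)) + ((1 - l) * h\<^sup>2 + l * h\<^sup>2)"
    using l l4 ab by (intro add_mono mult_left_mono mult_mono power_mono) auto
  also have "\<dots> = h * ?D / 2 + h\<^sup>2" by (simp add: algebra_simps)
  finally show ?thesis .
qed

end

section \<open>From short triangles to geodesic triangles\<close>

theorem corollary4p6:
  fixes M :: "'a set" and d :: "'a \<Rightarrow> 'a \<Rightarrow> real"
  assumes "CAT0_space M d"
  shows "rCAT0_space M d (2 + sqrt 3)"
proof -
  interpret CAT0_space M d by fact
  show ?thesis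
  proof
    show "0 < 2 + sqrt 3" by (simp add: add_pos_nonneg)
  next
    fix h L \<gamma> p p' i j s t u' v'
    assume h: "h = 1 / Max {1, d (p 0) (p 1), d (p 0) (p 2), d (p 1) (p 2)}"
      and tri: "short_triangle h L \<gamma> p" and cmp: "comparison_triangle p p'"
      and ij: "i < (3::nat)" "j < (3::nat)" and st: "s \<in> {0..L i}" "t \<in> {0..L j}"
      and u': "short_comparison_point (L i) (\<gamma> i) s (p' i) (p' (Suc i mod 3)) u'"
      and v': "short_comparison_point (L j) (\<gamma> j) t (p' j) (p' (Suc j mod 3)) v'"
    define m where "m = Max {1, d (p 0) (p 1), d (p 0) (p 2), d (p 1) (p 2)}"
    \<comment> \<open>Side 2 runs from \<open>p 2\<close> to \<open>p 0\<close>, whereas the maximum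
      lists \<open>d (p 0) (p 2)\<close>; hence \<open>commute\<close>.\<close>
    have m: "1 \<le> m" "\<forall>k<3. d (p k) (p (Suc k mod 3)) \<le> m"
      by (auto simp: m_def less_3_nat_iff commute numeral_2_eq_2)
    have hm: "h = 1 / m" using h by (simp add: m_def)
    have h01: "0 \<le> h" "h \<le> 1" using m by (simp_all add: hm)
    have p: "p k \<in> M" if "k < 3" for k using tri that by (auto simp: short_triangle_def)
    then have "\<exists>g. geodesic_segment g (p k) (p (Suc k mod 3))" if "k < 3" for k
      using that by (intro ex_geodesic) auto
    then obtain g where g: "\<And>k. k < 3 \<Longrightarrow> geodesic_segment (g k) (p k) (p (Suc k mod 3))"
      by metis
    have gtri: "geodesic_triangle g p" using p g by (auto simp: geodesic_triangle_def)
    \<comment> \<open>All that is needed about one side: each point of the short side is near a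
      point of the geodesic side with the same comparison point \<open>w\<close>.\<close>
    have side: "\<gamma> k r \<in> M \<and> g k (dist (p' k) w) \<in> M
        \<and> d (\<gamma> k r) (g k (dist (p' k) w)) \<le> sqrt (3 / 2)
        \<and> dist (p' k) w \<in> {0..d (p k) (p (Suc k mod 3))}
        \<and> geodesic_comparison_point (p k) (g k (dist (p' k) w)) (p' k) (p' (Suc k mod 3)) w"
      if k: "k < 3" and r: "r \<in> {0..L k}"
        and w: "short_comparison_point (L k) (\<gamma> k) r (p' k) (p' (Suc k mod 3)) w" for k r w
    proof -
      let ?D = "d (p k) (p (Suc k mod 3))"
      have seg: "short_segment h (L k) (\<gamma> k) (p k) (p (Suc k mod 3))"
        using tri k by (auto simp: short_triangle_def)
      have D: "dist (p' k) (p' (Suc k mod 3)) = ?D"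
        using cmp k by (auto simp: comparison_triangle_def)
      \<comment> \<open>The choice of \<open>h\<close> keeps the error bounded however long the side
        is: \<open>h * ?D / 2\<close> contributes 1/2 and \<open>h\<^sup>2\<close> contributes
        1.\<close>
      have "h * ?D \<le> 1" using m k by (simp add: hm divide_simps)
      moreover have "h\<^sup>2 \<le> 1" using h01 by (simp add: power_le_one)
      ultimately have "h * ?D / 2 + h\<^sup>2 \<le> 3 / 2" by simp
      with dist_short_segment_geodesic_le[OF p p g seg h01(1) r w D] k
      have "d (\<gamma> k r) (g k (dist (p' k) w)) \<le> sqrt (3 / 2)"
        by (intro real_le_rsqrt) auto
      moreover have wseg: "w \<in> closed_segment (p' k) (p' (Suc k mod 3))"
        using w by (simp add: short_comparison_point_def)
      then have dw: "dist (p' k) w \<in> {0..?D}"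
        using D by (metis atLeastAtMost_iff dist_commute dist_in_closed_segment(1) zero_le_dist)
      moreover have "d (p k) (g k (dist (p' k) w)) = dist (p' k) w"
      proof -
        have "d (g k 0) (g k (dist (p' k) w)) = \<bar>0 - dist (p' k) w\<bar>"
          using g[OF k] dw unfolding geodesic_segment_def
          by (meson atLeastAtMost_iff nonneg order_refl)
        then show ?thesis using g[OF k] by (simp add: geodesic_segment_def)
      qed
      moreover have "g k (dist (p' k) w) \<in> M"
        using g[OF k] dw by (auto simp: geodesic_segment_def)
      moreover have "\<gamma> k r \<in> M"
        using seg r mpath_in_space by (auto simp: short_segment_def)
      ultimately show ?thesis using wseg by (auto simp: geodesic_comparison_point_def)
    qed
    note u = side[OF ij(1) st(1) u'] and v = side[OF ij(2) st(2) v']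
    let ?u = "g i (dist (p' i) u')" and ?v = "g j (dist (p' j) v')"
    \<comment> \<open>The comparison triangle depends only on the vertices, so it serves the
      geodesic triangle unchanged.\<close>
    have "d ?u ?v \<le> dist u' v'"
      using CAT0_inequality[OF gtri cmp ij] u v by blast
    moreover have "d (\<gamma> i s) (\<gamma> j t) \<le> d (\<gamma> i s) ?u + d ?u ?v + d (\<gamma> j t) ?v"
      using u v triangle[of "\<gamma> i s" ?u "\<gamma> j t"] triangle[of ?u ?v "\<gamma> j t"] commute[of ?v]
      by fastforce
    \<comment> \<open>The two displacements cost at most 3/2 each, and
      \<open>3 \<le> 2 + sqrt 3\<close>.\<close>
    moreover have "sqrt (3 / 2) \<le> 3 / 2" "1 \<le> sqrt 3"
      by (rule real_le_lsqrt) (simp_all add: power2_eq_square)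
    ultimately show "d (\<gamma> i s) (\<gamma> j t) \<le> dist u' v' + (2 + sqrt 3)"
      using u v by linarith
  qed
qed

end
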